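(* As the parameter $\epsilon$ approaches zero, with the mesh size $\Delta x$ and the time step $\Delta t$ remaining unchanged, the fully discrete first-order IMEX $P_N$ scheme (R) for the one-dimensional gray radiative transfer equations, written out in the context, reduces to an implicit five-point scheme for the diffusion limit equation $$C_v\,\frac{\partial T^{(0)}}{\partial t}+a\,\frac{\partial}{\partial t}\big(T^{(0)}\big)^4=\frac{\partial}{\partial x}\Big(\frac{ac}{3\sigma}\,\frac{\partial}{\partial x}\big(T^{(0)}\big)^4\Big).$$
   Context: **Model.** The one-dimensional gray radiative transfer equations for the radiation intensity $I(t,x,\mu)$ and the material temperature $T(t,x)$ are $$\frac{\epsilon^2}{c}\partial_tI+\epsilon\mu\,\partial_xI=\sigma\Big(\frac12acT^4-I\Big),\qquad \epsilon^2C_v\,\partial_tT=\sigma\Big(\int_{-1}^1I\,d\mu-acT^4\Big),\qquad\mu\in[-1,1],$$ where $c$ is the speed of light, $a$ the radiation constant, $\sigma$ the (constant) opacity, and $C_v$ the specific heat capacity of the material, which may depend on $x$ and $T$. The $P_N$ approximation of truncation order $M$ uses the moments $I_l=\int_{-1}^1P_l(\mu)I\,d\mu$, $l=0,\dots,M$, where $P_l$ are the Legendre polynomials, with the closure $I_{M+1}=0$. As $\epsilon\to0$ the intensity $I$ approaches the Planckian $I^{(0)}=\frac12ac\big(T^{(0)}\big)^4$, where $T^{(0)}$ is the limiting temperature, the unknown of the diffusion limit equation. **Notation.** $a_{l-1}=\frac{l}{2l+1}$ and $b_{l+1}=\frac{l+1}{2l+1}$ for $l\ge1$ (these subscripted coefficients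 are distinct from the radiation constant $a$). The spatial mesh is uniform with mesh size $\Delta x$, and the time step is $\Delta t$. $I^n_{l,i}$ and $T^n_i$ are the numerical values of $I_l$ and $T$ in cell $i$ at time level $n$, $\hat I^n_{1,i}=I^n_{1,i}/\epsilon$, $I^n_{M+1,i}=0$, and $v_{\max}=1$ is the wave speed in the local Lax–Friedrichs flux. **Scheme (R).** For each cell $i$: $$\frac{\epsilon^2}{c}\frac{I_{0,i}^{n+1}-I_{0,i}^n}{\Delta t}+\epsilon^2\Big[\frac{\hat I_{1,i+1}^{n+1}-\hat I_{1,i-1}^{n+1}}{2\Delta x}-\frac{v_{\max}}{2\Delta x}\big(I_{0,i+1}^{n+1}-2I_{0,i}^{n+1}+I_{0,i-1}^{n+1}\big)\Big]=\sigma\big[ac(T_i^{n+1})^4-I_{0,i}^{n+1}\big],$$ $$\frac{\epsilon^2}{c}\frac{\hat I_{1,i}^{n+1}-\hat I_{1,i}^n}{\Delta t}+a_0\frac{I_{0,i+1}^{n+1}-I_{0,i-1}^{n+1}}{2\Delta x}-\frac{\epsilon v_{\max}}{2\Delta x}\big(\hat I_{1,i+1}^{n+1}-2\hat I_{1,i}^{n+1}+\hat I_{1,i-1}^{n+1}\big)+b_2\frac{I_{2,i+1}^n-I_{2,i-1}^n}{2\Delta x}=-\sigma\hat I_{1,i}^{n+1},$$ $$\epsilon^2C_v\frac{T_i^{n+1}-T_i^n}{\Delta t}=\sigma\big[I_{0,i}^{n+1}-ac(T_i^{n+1})^4\big],$$ and for $l=2,\dots,M$, $$\frac{\epsilon^2}{c}\frac{I_{l,i}^{n+1}-I_{l,i}^n}{\Delta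 t}+\epsilon a_{l-1}\frac{I_{l-1,i+1}^{n+1}-I_{l-1,i-1}^{n+1}}{2\Delta x}+\epsilon b_{l+1}\frac{I_{l+1,i+1}^n-I_{l+1,i-1}^n}{2\Delta x}-\frac{\epsilon v_{\max}}{2\Delta x}\big(I_{l,i+1}^n-2I_{l,i}^n+I_{l,i-1}^n\big)=-\sigma I_{l,i}^{n+1}.$$ *)

theory Defs
  imports "HOL-Analysis.Analysis" "HOL-Library.Landau_Symbols"
begin

text \<open>
  Discrete unknowns are indexed by the moment number (natural), the time level (natural) and the
  cell (integer, so the mesh is unbounded; periodic data are the special case of periodic
  functions of the cell index).
\<close>

definition leg_a :: "nat \<Rightarrow> real" where
  "leg_a k = real (k + 1) / real (2 * k + 3)"

definition leg_b :: "nat \<Rightarrow> real" where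
  "leg_b k = real k / (2 * real k - 1)"

lemma leg_a_pred: "l \<ge> 1 \<Longrightarrow> leg_a (l - 1) = real l / real (2 * l + 1)"
  by (cases l) (simp_all add: leg_a_def algebra_simps)

lemma leg_b_succ: "leg_b (l + 1) = real (l + 1) / real (2 * l + 1)"
  by (simp add: leg_b_def)

definition v_max :: real where
  "v_max = 1"

definition central :: "real \<Rightarrow> (int \<Rightarrow> real) \<Rightarrow> int \<Rightarrow> real" where
  "central h f i = (f (i + 1) - f (i - 1)) / (2 * h)"

definition viscosity :: "real \<Rightarrow> (int \<Rightarrow> real) \<Rightarrow> int \<Rightarrow> real" where
  "viscosity h f i = v_max / (2 * h) * (f (i + 1) - 2 * f i + f (i - 1))"

text \<open>
  The heat capacity \<open>Cv x T\<close> may depend on position and temperature. In the step from temperature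
  \<open>S\<close> to temperature \<open>S'\<close> it is evaluated at \<open>\<theta> S S'\<close>: the choice \<open>\<theta> S S' = S'\<close> is the implicit
  evaluation, \<open>\<theta> S S' = S\<close> the lagged one. Cell \<open>i\<close> is centred at \<open>x0 + i dx\<close>.
\<close>

definition cell :: "real \<Rightarrow> real \<Rightarrow> int \<Rightarrow> real" where
  "cell x0 dx i = x0 + of_int i * dx"

definition imex_PN_solution ::
  "real \<Rightarrow> real \<Rightarrow> real \<Rightarrow> (real \<Rightarrow> real \<Rightarrow> real) \<Rightarrow> (real \<Rightarrow> real \<Rightarrow> real) \<Rightarrow> real \<Rightarrow> real \<Rightarrow> real \<Rightarrow> nat \<Rightarrow>
   real \<Rightarrow> (nat \<Rightarrow> nat \<Rightarrow> int \<Rightarrow> real) \<Rightarrow> (nat \<Rightarrow> int \<Rightarrow> real) \<Rightarrow> bool" where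
  "imex_PN_solution c a \<sigma> Cv \<theta> x0 dx dt M \<epsilon> I T \<longleftrightarrow>
    (let Ih = (\<lambda>n i. I 1 n i / \<epsilon>) in
      (\<forall>n i. I (M + 1) n i = 0) \<and>
      (\<forall>n i. \<epsilon>\<^sup>2 / c * ((I 0 (n + 1) i - I 0 n i) / dt)
           + \<epsilon>\<^sup>2 * (central dx (Ih (n + 1)) i - viscosity dx (I 0 (n + 1)) i)
           = \<sigma> * (a * c * (T (n + 1) i) ^ 4 - I 0 (n + 1) i)) \<and>
      (\<forall>n i. \<epsilon>\<^sup>2 / c * ((Ih (n + 1) i - Ih n i) / dt)
           + leg_a 0 * central dx (I 0 (n + 1)) i
           - \<epsilon> * viscosity dx (Ih (n + 1)) i
           + leg_b 2 * central dx (I 2 n) i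
           = - \<sigma> * Ih (n + 1) i) \<and>
      (\<forall>n i. \<epsilon>\<^sup>2 * Cv (cell x0 dx i) (\<theta> (T n i) (T (n + 1) i)) * ((T (n + 1) i - T n i) / dt)
           = \<sigma> * (I 0 (n + 1) i - a * c * (T (n + 1) i) ^ 4)) \<and>
      (\<forall>l\<in>{2..M}. \<forall>n i. \<epsilon>\<^sup>2 / c * ((I l (n + 1) i - I l n i) / dt)
           + \<epsilon> * leg_a (l - 1) * central dx (I (l - 1) (n + 1)) i
           + \<epsilon> * leg_b (l + 1) * central dx (I (l + 1) n) i
           - \<epsilon> * viscosity dx (I l n) i
           = - \<sigma> * I l (n + 1) i))"

text \<open>
  Legendre moments of the Planckian \<open>a c T\<^sup>4 / 2\<close>: only the zeroth one survives, and it equals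
  \<open>\<integral>\<^sub>-\<^sub>1\<^sup>1 a c T\<^sup>4 / 2 d\<mu> = a c T\<^sup>4\<close>.
\<close>

definition planck_moment :: "real \<Rightarrow> real \<Rightarrow> real \<Rightarrow> nat \<Rightarrow> real" where
  "planck_moment a c T l = (if l = 0 then a * c * T ^ 4 else 0)"

text \<open>
  The five-point scheme at a cell centred at \<open>x\<close>, with old value \<open>S\<close> there and new values
  \<open>Tmm, Tm, T0, Tp, Tpp\<close> at \<open>x - 2dx, \<dots>, x + 2dx\<close>. The wide second difference comes from
  composing the two central differences for \<open>I\<^sub>0\<close> and \<open>I\<^sub>1/\<epsilon>\<close>; the compact one is the
  numerical viscosity of the \<open>I\<^sub>0\<close> equation, which is not scaled by \<open>\<epsilon>\<close> and so survives the
  limit, as a perturbation of order \<open>dx\<close>.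
\<close>

definition five_point_residual ::
  "real \<Rightarrow> real \<Rightarrow> real \<Rightarrow> (real \<Rightarrow> real \<Rightarrow> real) \<Rightarrow> (real \<Rightarrow> real \<Rightarrow> real) \<Rightarrow> real \<Rightarrow> real \<Rightarrow> real \<Rightarrow>
   real \<Rightarrow> real \<Rightarrow> real \<Rightarrow> real \<Rightarrow> real \<Rightarrow> real \<Rightarrow> real" where
  "five_point_residual c a \<sigma> Cv \<theta> dx dt x S Tmm Tm T0 Tp Tpp =
     Cv x (\<theta> S T0) * ((T0 - S) / dt) + a * ((T0 ^ 4 - S ^ 4) / dt)
     - a * c / (3 * \<sigma>) * ((Tpp ^ 4 - 2 * T0 ^ 4 + Tmm ^ 4) / (4 * dx\<^sup>2))
     - a * c * v_max / (2 * dx) * (Tp ^ 4 - 2 * T0 ^ 4 + Tm ^ 4)"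

definition diffusion_residual ::
  "real \<Rightarrow> real \<Rightarrow> real \<Rightarrow> (real \<Rightarrow> real \<Rightarrow> real) \<Rightarrow> (real \<Rightarrow> real \<Rightarrow> real) \<Rightarrow> real \<Rightarrow> real \<Rightarrow> real" where
  "diffusion_residual c a \<sigma> Cv T t x =
     Cv x (T t x) * deriv (\<lambda>s. T s x) t + a * deriv (\<lambda>s. (T s x) ^ 4) t
     - deriv (\<lambda>y. a * c / (3 * \<sigma>) * deriv (\<lambda>z. (T t z) ^ 4) y) x"

definition C12_on :: "(real \<times> real) set \<Rightarrow> (real \<Rightarrow> real \<Rightarrow> real) \<Rightarrow> bool" where
  "C12_on \<Omega> T \<longleftrightarrow> (\<exists>Tt Tx Txx.
     (\<forall>(t, x)\<in>\<Omega>. ((\<lambda>s. T s x) has_real_derivative Tt t x) (at t) \<and>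
        ((\<lambda>y. T t y) has_real_derivative Tx t x) (at x) \<and>
        ((\<lambda>y. Tx t y) has_real_derivative Txx t x) (at x)) \<and>
     continuous_on \<Omega> (\<lambda>(t, x). Tt t x) \<and>
     continuous_on \<Omega> (\<lambda>(t, x). Tx t x) \<and>
     continuous_on \<Omega> (\<lambda>(t, x). Txx t x))"

text \<open>
  Consistency with the diffusion equation: on every classically smooth function (a solution or
  not) the discrete operator tends to the differential one as the two mesh parameters tend to zero
  independently of each other. On solutions this says that the truncation error vanishes.
\<close>

definition five_point_consistent ::
  "real \<Rightarrow> real \<Rightarrow> real \<Rightarrow> (real \<Rightarrow> real \<Rightarrow> real) \<Rightarrow> (real \<Rightarrow> real \<Rightarrow> real) \<Rightarrow> bool" where
  "five_point_consistent c a \<sigma> Cv \<theta> \<longleftrightarrow>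
     (\<forall>\<Omega> T t x. open \<Omega> \<longrightarrow> C12_on \<Omega> T \<longrightarrow> (t, x) \<in> \<Omega> \<longrightarrow>
        ((\<lambda>(dt, dx). five_point_residual c a \<sigma> Cv \<theta> dx dt x (T t x)
            (T (t + dt) (x - 2 * dx)) (T (t + dt) (x - dx)) (T (t + dt) x)
            (T (t + dt) (x + dx)) (T (t + dt) (x + 2 * dx)))
          \<longlongrightarrow> diffusion_residual c a \<sigma> Cv T t x) (at_right 0 \<times>\<^sub>F at_right 0))"

end

theory Submission
  imports Defs
begin

text \<open>
  The temperature equation forces \<open>I\<^sub>0\<close> to the Planckian, and boundedness of the
  moments makes the relaxation terms drive \<open>I\<^sub>l\<close> to \<open>0\<close> for \<open>l \<ge> 1\<close>. The flux equation then yields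
  the limit of \<open>I\<^sub>1/\<epsilon>\<close>: a central difference of the Planckian, since the viscosity of \<open>I\<^sub>1/\<epsilon>\<close> carries
  a factor \<open>\<epsilon>\<close> and thus acts on \<open>I\<^sub>1\<close> itself. The \<open>I\<^sub>0\<close> and temperature equations are coupled
  stiffly, but their sum is \<open>\<epsilon>\<^sup>2\<close> times a relation whose limit is the five-point scheme.
  Consistency reduces to Lagrange remainders at the new time level, where joint continuity of the
  second derivative makes them converge.
\<close>

section \<open>Bounds and limits of the difference operators\<close>

text \<open>The bridge from boundedness of the moments to convergence: a factor
  \<open>\<epsilon>\<close> makes a bounded expression vanish even if that expression has no
  limit.\<close>

lemma tendsto_mult_bigo_1:
  fixes f g :: "'a \<Rightarrow> real"
  assumes "(g \<longlongrightarrow> 0) F" "f \<in> O[F](\<lambda>_. 1)"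
  shows "((\<lambda>x. g x * f x) \<longlongrightarrow> 0) F"
proof -
  have "g \<in> o[F](\<lambda>_. 1)"
    using assms(1) by (intro smalloI_tendsto) auto
  from landau_o.small_big_mult[OF this assms(2)] show ?thesis
    by (auto dest: smalloD_tendsto)
qed

lemma bigo_1_central:
  fixes f :: "'a \<Rightarrow> int \<Rightarrow> real"
  assumes "\<And>i. (\<lambda>x. f x i) \<in> O[F](\<lambda>_. 1)"
  shows "(\<lambda>x. central h (f x) i) \<in> O[F](\<lambda>_. 1)"
  \<comment> \<open>At \<open>h = 0\<close> division by zero yields the constant 0; otherwise
    division by a nonzero constant preserves boundedness.\<close>
  unfolding central_def by (cases "h = 0") (auto intro!: sum_in_bigo assms)

lemma bigo_1_viscosity:
  fixes f :: "'a \<Rightarrow> int \<Rightarrow> real"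
  assumes "\<And>i. (\<lambda>x. f x i) \<in> O[F](\<lambda>_. 1)"
  shows "(\<lambda>x. viscosity h (f x) i) \<in> O[F](\<lambda>_. 1)"
  unfolding viscosity_def by (cases "h = 0") (auto simp: v_max_def intro!: sum_in_bigo assms)

lemma tendsto_central:
  fixes f :: "'a \<Rightarrow> int \<Rightarrow> real"
  assumes "\<And>i. ((\<lambda>x. f x i) \<longlongrightarrow> g i) F"
  shows "((\<lambda>x. central h (f x) i) \<longlongrightarrow> central h g i) F"
  \<comment> \<open>As a product with the constant inverse, the quotient raises no side condition on
    its denominator.\<close>
  unfolding central_def divide_inverse by (intro tendsto_intros assms)

lemma tendsto_viscosity:
  fixes f :: "'a \<Rightarrow> int \<Rightarrow> real"
  assumes "\<And>i. ((\<lambda>x. f x i) \<longlongrightarrow> g i) F"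
  shows "((\<lambda>x. viscosity h (f x) i) \<longlongrightarrow> viscosity h g i) F"
  unfolding viscosity_def divide_inverse by (intro tendsto_intros assms)

lemma viscosity_divide: "viscosity h (\<lambda>j. f j / e) i = viscosity h f i / e"
  by (simp add: viscosity_def flip: diff_divide_distrib add_divide_distrib)

section \<open>The equations with their powers of \<epsilon> made explicit\<close>

text \<open>Each equation is put into the form in which its limit can be read off. In
  \<open>imex_energy\<close> the stiff source has cancelled between two equations and
  \<open>\<epsilon>\<^sup>2\<close> has been divided out, so the only quotient by
  \<open>\<epsilon>\<close> left is the scaled flux, which \<open>imex_flux\<close> expresses
  without negative powers of \<open>\<epsilon>\<close>.\<close>

lemma imex_PN_solutionD:
  assumes "imex_PN_solution c a \<sigma> Cv \<theta> x0 dx dt M \<epsilon> I T" and "\<epsilon> > 0" "\<sigma> > 0"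
  shows imex_closure: "I (M + 1) n i = 0"
    and imex_I0: "I 0 (n + 1) i = a * c * T (n + 1) i ^ 4
      + \<epsilon>\<^sup>2 / \<sigma> * (Cv (cell x0 dx i) (\<theta> (T n i) (T (n + 1) i)) * ((T (n + 1) i - T n i) / dt))"
    and imex_energy: "(I 0 (n + 1) i - I 0 n i) / (c * dt)
      + central dx (\<lambda>j. I 1 (n + 1) j / \<epsilon>) i - viscosity dx (I 0 (n + 1)) i
      + Cv (cell x0 dx i) (\<theta> (T n i) (T (n + 1) i)) * ((T (n + 1) i - T n i) / dt) = 0"
    and imex_flux: "I 1 (n + 1) i / \<epsilon> = - (leg_a 0 * central dx (I 0 (n + 1)) i
      + leg_b 2 * central dx (I 2 n) i - viscosity dx (I 1 (n + 1)) i
      + \<epsilon> * ((I 1 (n + 1) i - I 1 n i) / (c * dt))) / \<sigma>"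
    and imex_moment: "l \<in> {2..M} \<Longrightarrow> I l (n + 1) i =
      - (\<epsilon> * (\<epsilon> * ((I l (n + 1) i - I l n i) / (c * dt))
         + leg_a (l - 1) * central dx (I (l - 1) (n + 1)) i
         + leg_b (l + 1) * central dx (I (l + 1) n) i - viscosity dx (I l n) i)) / \<sigma>"
proof -
  \<comment> \<open>Naming the heating term keeps \<open>Cv\<close> and \<open>\<theta>\<close> away
    from the simplifier; it enters as one opaque summand.\<close>
  define k where "k = Cv (cell x0 dx i) (\<theta> (T n i) (T (n + 1) i)) * ((T (n + 1) i - T n i) / dt)"
  note eqs = assms(1)[unfolded imex_PN_solution_def Let_def]
  show "I (M + 1) n i = 0" using eqs by blast
  have quot: "\<epsilon>\<^sup>2 / c * (z / dt) = \<epsilon>\<^sup>2 * (z / (c * dt))" for z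
    by simp
  have 0: "\<epsilon>\<^sup>2 / c * ((I 0 (n + 1) i - I 0 n i) / dt)
           + \<epsilon>\<^sup>2 * (central dx (\<lambda>j. I 1 (n + 1) j / \<epsilon>) i - viscosity dx (I 0 (n + 1)) i)
           = \<sigma> * (a * c * (T (n + 1) i) ^ 4 - I 0 (n + 1) i)"
    using eqs by blast
  have T: "\<epsilon>\<^sup>2 * k = \<sigma> * (I 0 (n + 1) i - a * c * (T (n + 1) i) ^ 4)"
    unfolding k_def mult.assoc[symmetric] using eqs by blast
  have 1: "\<epsilon>\<^sup>2 / c * ((I 1 (n + 1) i / \<epsilon> - I 1 n i / \<epsilon>) / dt)
           + leg_a 0 * central dx (I 0 (n + 1)) i
           - \<epsilon> * viscosity dx (\<lambda>j. I 1 (n + 1) j / \<epsilon>) i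
           + leg_b 2 * central dx (I 2 n) i
           = - \<sigma> * (I 1 (n + 1) i / \<epsilon>)"
    using eqs by blast
  show "I 0 (n + 1) i = a * c * T (n + 1) i ^ 4
      + \<epsilon>\<^sup>2 / \<sigma> * (Cv (cell x0 dx i) (\<theta> (T n i) (T (n + 1) i)) * ((T (n + 1) i - T n i) / dt))"
    using T assms(2,3) unfolding k_def[symmetric] by (simp add: field_simps)
  have "\<epsilon>\<^sup>2 * ((I 0 (n + 1) i - I 0 n i) / (c * dt)
      + central dx (\<lambda>j. I 1 (n + 1) j / \<epsilon>) i - viscosity dx (I 0 (n + 1)) i + k) = 0"
    using 0 T by (simp only: quot distrib_left right_diff_distrib)
  then show "(I 0 (n + 1) i - I 0 n i) / (c * dt)
      + central dx (\<lambda>j. I 1 (n + 1) j / \<epsilon>) i - viscosity dx (I 0 (n + 1)) i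
      + Cv (cell x0 dx i) (\<theta> (T n i) (T (n + 1) i)) * ((T (n + 1) i - T n i) / dt) = 0"
    unfolding k_def[symmetric] using assms(2) by simp
  \<comment> \<open>One of the two powers of \<open>\<epsilon>\<close> is spent on the scaling of
    \<open>I 1\<close>; the other stays and will remove the time difference in the limit.\<close>
  have diff: "\<epsilon>\<^sup>2 / c * ((I 1 (n + 1) i / \<epsilon> - I 1 n i / \<epsilon>) / dt)
      = \<epsilon> * ((I 1 (n + 1) i - I 1 n i) / (c * dt))"
    using assms(2) by (simp add: power2_eq_square flip: diff_divide_distrib)
  have visc: "\<epsilon> * viscosity dx (\<lambda>j. I 1 (n + 1) j / \<epsilon>) i = viscosity dx (I 1 (n + 1)) i"
    using assms(2) by (simp add: viscosity_divide)
  have "I 1 (n + 1) i / \<epsilon> * \<sigma> = - (leg_a 0 * central dx (I 0 (n + 1)) i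
      + leg_b 2 * central dx (I 2 n) i - viscosity dx (I 1 (n + 1)) i
      + \<epsilon> * ((I 1 (n + 1) i - I 1 n i) / (c * dt)))"
    using 1[unfolded diff visc] by (simp add: algebra_simps)
  then show "I 1 (n + 1) i / \<epsilon> = - (leg_a 0 * central dx (I 0 (n + 1)) i
      + leg_b 2 * central dx (I 2 n) i - viscosity dx (I 1 (n + 1)) i
      + \<epsilon> * ((I 1 (n + 1) i - I 1 n i) / (c * dt))) / \<sigma>"
    using assms(3) by (intro eq_divide_imp) auto
  assume "l \<in> {2..M}"
  then have "\<epsilon>\<^sup>2 / c * ((I l (n + 1) i - I l n i) / dt)
           + \<epsilon> * leg_a (l - 1) * central dx (I (l - 1) (n + 1)) i
           + \<epsilon> * leg_b (l + 1) * central dx (I (l + 1) n) i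
           - \<epsilon> * viscosity dx (I l n) i
           = - \<sigma> * I l (n + 1) i"
    using eqs by blast
  moreover have "\<epsilon>\<^sup>2 / c * ((I l (n + 1) i - I l n i) / dt) = \<epsilon> * (\<epsilon> * ((I l (n + 1) i - I l n i) / (c * dt)))"
    by (simp add: power2_eq_square)
  ultimately show "I l (n + 1) i =
      - (\<epsilon> * (\<epsilon> * ((I l (n + 1) i - I l n i) / (c * dt))
         + leg_a (l - 1) * central dx (I (l - 1) (n + 1)) i
         + leg_b (l + 1) * central dx (I (l + 1) n) i - viscosity dx (I l n) i)) / \<sigma>"
    using assms(3) by (simp only: eq_divide_eq) (simp add: algebra_simps)
qed

section \<open>The limit \<epsilon> to 0 on a fixed mesh\<close>

text \<open>The limits are found in the order \<open>I 0\<close>, moments from 2 on,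
  \<open>I 1\<close>, and finally \<open>I 1\<close> divided by \<open>\<epsilon>\<close>. Only the
  last step needs limits of other moments; for the higher moments and \<open>I 1\<close> bounds
  suffice. Convergence of the scaled flux is thus derived from the flux equation and not
  assumed.\<close>

lemma imex_PN_limit:
  fixes c a \<sigma> x0 dx dt :: real
    and Cv \<theta> :: "real \<Rightarrow> real \<Rightarrow> real"
    and I :: "real \<Rightarrow> nat \<Rightarrow> nat \<Rightarrow> int \<Rightarrow> real"
    and T :: "real \<Rightarrow> nat \<Rightarrow> int \<Rightarrow> real"
  assumes pos: "c > 0" "\<sigma> > 0" "dx > 0" "dt > 0"
    and order: "M \<ge> 1"
    and Cv_cont: "\<And>x. continuous_on UNIV (Cv x)"
    and theta_cont: "continuous_on UNIV (\<lambda>(S, S'). \<theta> S S')"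
    and scheme: "\<forall>\<^sub>F \<epsilon> in at_right 0. imex_PN_solution c a \<sigma> Cv \<theta> x0 dx dt M \<epsilon> (I \<epsilon>) (T \<epsilon>)"
    and T_lim: "\<And>n i. ((\<lambda>\<epsilon>. T \<epsilon> n i) \<longlongrightarrow> T0 n i) (at_right 0)"
    and I_bounded: "\<And>l n i. l \<le> M \<Longrightarrow> (\<lambda>\<epsilon>. I \<epsilon> l n i) \<in> O[at_right 0](\<lambda>_. 1)"
    and I_init: "\<And>l i. l \<le> M \<Longrightarrow>
      ((\<lambda>\<epsilon>. I \<epsilon> l 0 i) \<longlongrightarrow> planck_moment a c (T0 0 i) l) (at_right 0)"
  shows "five_point_residual c a \<sigma> Cv \<theta> dx dt (cell x0 dx i) (T0 n i)
            (T0 (n + 1) (i - 2)) (T0 (n + 1) (i - 1)) (T0 (n + 1) i)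
            (T0 (n + 1) (i + 1)) (T0 (n + 1) (i + 2)) = 0"
proof -
  let ?F = "at_right (0::real)"
  let ?u = "\<lambda>n i. a * c * T0 n i ^ 4"
  let ?q = "\<lambda>n i. Cv (cell x0 dx i) (\<theta> (T0 n i) (T0 (n + 1) i)) * ((T0 (n + 1) i - T0 n i) / dt)"
  let ?k = "\<lambda>\<epsilon> n i. Cv (cell x0 dx i) (\<theta> (T \<epsilon> n i) (T \<epsilon> (n + 1) i)) * ((T \<epsilon> (n + 1) i - T \<epsilon> n i) / dt)"
  have sol: "\<forall>\<^sub>F \<epsilon> in ?F. imex_PN_solution c a \<sigma> Cv \<theta> x0 dx dt M \<epsilon> (I \<epsilon>) (T \<epsilon>) \<and> \<epsilon> > 0"
    using scheme by (auto simp: eventually_conj_iff eventually_at_right_less)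
  note D = imex_PN_solutionD[OF conjunct1 conjunct2 pos(2)]
  have eps: "((\<lambda>\<epsilon>. \<epsilon>) \<longlongrightarrow> 0) ?F"
    by (rule tendsto_ident_at)
  have k_lim: "((\<lambda>\<epsilon>. ?k \<epsilon> n i) \<longlongrightarrow> ?q n i) ?F" for n i
  proof -
    have "((\<lambda>\<epsilon>. case (T \<epsilon> n i, T \<epsilon> (n + 1) i) of (S, S') \<Rightarrow> \<theta> S S')
        \<longlongrightarrow> (case (T0 n i, T0 (n + 1) i) of (S, S') \<Rightarrow> \<theta> S S')) ?F"
      by (rule continuous_on_tendsto_compose[OF theta_cont tendsto_Pair[OF T_lim T_lim]]) auto
    then have "((\<lambda>\<epsilon>. Cv (cell x0 dx i) (\<theta> (T \<epsilon> n i) (T \<epsilon> (n + 1) i)))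
        \<longlongrightarrow> Cv (cell x0 dx i) (\<theta> (T0 n i) (T0 (n + 1) i))) ?F"
      by (intro continuous_on_tendsto_compose[OF Cv_cont]) auto
    then show ?thesis
      unfolding divide_inverse by (intro tendsto_intros T_lim)
  qed
  \<comment> \<open>The closure extends the bounds to \<open>l = M + 1\<close>, a moment that occurs
    in the equation of the top moment and, if \<open>M = 1\<close>, in the flux equation.\<close>
  have bounded: "(\<lambda>\<epsilon>. I \<epsilon> l n i) \<in> O[?F](\<lambda>_. 1)" if "l \<le> M + 1" for l n i
  proof (cases "l = M + 1")
    case True
    have "\<forall>\<^sub>F \<epsilon> in ?F. I \<epsilon> l n i = 0"
      using sol unfolding True by eventually_elim (rule D(1))
    then show ?thesis
      by (subst landau_o.big.in_cong) auto
  qed (use that I_bounded in auto)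
  have I0_lim: "((\<lambda>\<epsilon>. I \<epsilon> 0 n i) \<longlongrightarrow> ?u n i) ?F" for n i
  \<comment> \<open>The scheme determines only levels \<open>n + 1\<close>; at level 0 the Planckian
    limit comes from the initial data.\<close>
  proof (cases n)
    case 0
    with I_init[of 0 i] show ?thesis by (simp add: planck_moment_def)
  next
    case (Suc m)
    have "((\<lambda>\<epsilon>. a * c * T \<epsilon> (m + 1) i ^ 4 + \<epsilon>\<^sup>2 / \<sigma> * ?k \<epsilon> m i)
        \<longlongrightarrow> a * c * T0 (m + 1) i ^ 4 + 0\<^sup>2 / \<sigma> * ?q m i) ?F"
      using pos by (intro tendsto_intros k_lim T_lim eps) auto
    moreover have "\<forall>\<^sub>F \<epsilon> in ?F. a * c * T \<epsilon> (m + 1) i ^ 4 + \<epsilon>\<^sup>2 / \<sigma> * ?k \<epsilon> m i = I \<epsilon> 0 (m + 1) i"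
      using sol by eventually_elim (rule D(2)[symmetric])
    ultimately have "((\<lambda>\<epsilon>. I \<epsilon> 0 (m + 1) i) \<longlongrightarrow> a * c * T0 (m + 1) i ^ 4 + 0\<^sup>2 / \<sigma> * ?q m i) ?F"
      by (rule Lim_transform_eventually)
    then show ?thesis by (simp add: Suc)
  qed
  have diff_bounded: "(\<lambda>\<epsilon>. (I \<epsilon> l (n + 1) i - I \<epsilon> l n i) / (c * dt)) \<in> O[?F](\<lambda>_. 1)"
    if "l \<le> M" for l n i
    using that pos by (auto intro!: sum_in_bigo bounded)
  have eps_bounded: "(\<lambda>\<epsilon>. \<epsilon>) \<in> O[?F](\<lambda>_. 1)"
    by (rule bigoI_tendsto) (use eps in auto)
  have eps_mult: "(\<lambda>\<epsilon>. \<epsilon> * f \<epsilon>) \<in> O[?F](\<lambda>_. 1)" if "f \<in> O[?F](\<lambda>_. 1)" for f :: "real \<Rightarrow> real"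
    using landau_o.big.mult[OF eps_bounded that] by simp
  have c_mult: "(\<lambda>\<epsilon>. k * f \<epsilon>) \<in> O[?F](\<lambda>_. 1)" if "f \<in> O[?F](\<lambda>_. 1)" for f :: "real \<Rightarrow> real" and k
    using that by (cases "k = 0") auto
  have Il_lim: "((\<lambda>\<epsilon>. I \<epsilon> l n i) \<longlongrightarrow> 0) ?F" if l: "l \<in> {2..M}" for l n i
  \<comment> \<open>Level 0 matters because the flux equation takes \<open>I 2\<close> explicitly,
    at the old time level.\<close>
  proof (cases n)
    case 0
    with I_init[of l i] l show ?thesis by (simp add: planck_moment_def)
  next
    case (Suc m)
    let ?R = "\<lambda>\<epsilon>. \<epsilon> * ((I \<epsilon> l (m + 1) i - I \<epsilon> l m i) / (c * dt))
         + leg_a (l - 1) * central dx (I \<epsilon> (l - 1) (m + 1)) i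
         + leg_b (l + 1) * central dx (I \<epsilon> (l + 1) m) i - viscosity dx (I \<epsilon> l m) i"
    \<comment> \<open>Since bounds on the neighbouring moments are enough, no induction on
      \<open>l\<close> or on the time level is required.\<close>
    have "?R \<in> O[?F](\<lambda>_. 1)"
      using l by (intro sum_in_bigo eps_mult c_mult diff_bounded bigo_1_central bigo_1_viscosity bounded) auto
    from tendsto_mult_bigo_1[OF eps this]
    have "((\<lambda>\<epsilon>. - (\<epsilon> * ?R \<epsilon>) / \<sigma>) \<longlongrightarrow> - 0 / \<sigma>) ?F"
      using pos by (intro tendsto_intros) auto
    moreover have "\<forall>\<^sub>F \<epsilon> in ?F. - (\<epsilon> * ?R \<epsilon>) / \<sigma> = I \<epsilon> l (m + 1) i"
      using sol by eventually_elim (rule D(5)[symmetric], use l in auto)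
    ultimately have "((\<lambda>\<epsilon>. I \<epsilon> l (m + 1) i) \<longlongrightarrow> - 0 / \<sigma>) ?F"
      by (rule Lim_transform_eventually)
    then show ?thesis by (simp add: Suc)
  qed
  have I2_lim: "((\<lambda>\<epsilon>. I \<epsilon> 2 n i) \<longlongrightarrow> 0) ?F" for n i
  \<comment> \<open>For \<open>M = 1\<close> the second moment is the closure moment and vanishes
    identically; otherwise it is one of the relaxing moments.\<close>
  proof (cases "M = 1")
    case True
    have "\<forall>\<^sub>F \<epsilon> in ?F. 0 = I \<epsilon> 2 n i"
      using sol by eventually_elim (use D(1) True in \<open>fastforce simp: numeral_2_eq_2\<close>)
    then show ?thesis
      by (rule Lim_transform_eventually[OF tendsto_const])
  qed (use order Il_lim in auto)
  let ?G = "\<lambda>n i \<epsilon>. leg_a 0 * central dx (I \<epsilon> 0 (n + 1)) i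
      + leg_b 2 * central dx (I \<epsilon> 2 n) i - viscosity dx (I \<epsilon> 1 (n + 1)) i
      + \<epsilon> * ((I \<epsilon> 1 (n + 1) i - I \<epsilon> 1 n i) / (c * dt))"
  \<comment> \<open>A bootstrap: the bracket \<open>?G\<close> contains the viscosity of
    \<open>I 1\<close>, so \<open>I 1\<close> must first be shown to vanish, from boundedness of
    \<open>?G\<close>, before \<open>?G\<close> can be given a limit.\<close>
  have I1_lim: "((\<lambda>\<epsilon>. I \<epsilon> 1 (n + 1) i) \<longlongrightarrow> 0) ?F" for n i
  proof -
    have "?G n i \<in> O[?F](\<lambda>_. 1)"
      using order by (intro sum_in_bigo eps_mult c_mult diff_bounded bigo_1_central bigo_1_viscosity bounded) auto
    from tendsto_mult_bigo_1[OF eps this]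
    have "((\<lambda>\<epsilon>. - (\<epsilon> * ?G n i \<epsilon>) / \<sigma>) \<longlongrightarrow> - 0 / \<sigma>) ?F"
      using pos by (intro tendsto_intros) auto
    moreover have "\<forall>\<^sub>F \<epsilon> in ?F. - (\<epsilon> * ?G n i \<epsilon>) / \<sigma> = I \<epsilon> 1 (n + 1) i"
      using sol
    proof eventually_elim
      case (elim \<epsilon>)
      from D(4)[OF elim elim, of n i] have "I \<epsilon> 1 (n + 1) i = \<epsilon> * (- ?G n i \<epsilon> / \<sigma>)"
        using elim by (simp only: divide_eq_eq) (auto simp: mult.commute)
      then show ?case by (simp only: mult_minus_right times_divide_eq_right minus_divide_left mult_minus_left)
    qed
    ultimately have "((\<lambda>\<epsilon>. I \<epsilon> 1 (n + 1) i) \<longlongrightarrow> - 0 / \<sigma>) ?F"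
      by (rule Lim_transform_eventually)
    then show ?thesis by simp
  qed
  have flux_lim: "((\<lambda>\<epsilon>. I \<epsilon> 1 (n + 1) i / \<epsilon>) \<longlongrightarrow> - (leg_a 0 * central dx (?u (n + 1)) i) / \<sigma>) ?F" for n i
  proof -
    \<comment> \<open>Boundedness of the unscaled \<open>I 1\<close> suffices here. This covers
      level 0, where \<open>I 1\<close> divided by \<open>\<epsilon>\<close> may fail to
      converge.\<close>
    have 1: "((\<lambda>\<epsilon>. \<epsilon> * ((I \<epsilon> 1 (n + 1) i - I \<epsilon> 1 n i) / (c * dt))) \<longlongrightarrow> 0) ?F"
      by (rule tendsto_mult_bigo_1[OF eps diff_bounded[OF order]])
    have "((\<lambda>\<epsilon>. - ?G n i \<epsilon> / \<sigma>) \<longlongrightarrow> - (leg_a 0 * central dx (?u (n + 1)) i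
        + leg_b 2 * central dx (\<lambda>_. 0) i - viscosity dx (\<lambda>_. 0) i + 0) / \<sigma>) ?F"
      using pos by (intro tendsto_intros tendsto_central tendsto_viscosity I0_lim I1_lim I2_lim 1) auto
    also have "central dx (\<lambda>_. 0) i = 0" by (simp add: central_def)
    also have "viscosity dx (\<lambda>_. 0) i = 0" by (simp add: viscosity_def)
    finally have *: "((\<lambda>\<epsilon>. - ?G n i \<epsilon> / \<sigma>) \<longlongrightarrow> - (leg_a 0 * central dx (?u (n + 1)) i) / \<sigma>) ?F"
      by simp
    have "\<forall>\<^sub>F \<epsilon> in ?F. - ?G n i \<epsilon> / \<sigma> = I \<epsilon> 1 (n + 1) i / \<epsilon>"
      using sol by eventually_elim (rule D(4)[symmetric])
    from Lim_transform_eventually[OF * this] show ?thesis .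
  qed
  let ?E = "(?u (n + 1) i - ?u n i) * inverse (c * dt)
      + central dx (\<lambda>j. - (leg_a 0 * central dx (?u (n + 1)) j) / \<sigma>) i - viscosity dx (?u (n + 1)) i + ?q n i"
  let ?e = "\<lambda>\<epsilon>. (I \<epsilon> 0 (n + 1) i - I \<epsilon> 0 n i) * inverse (c * dt)
      + central dx (\<lambda>j. I \<epsilon> 1 (n + 1) j / \<epsilon>) i - viscosity dx (I \<epsilon> 0 (n + 1)) i + ?k \<epsilon> n i"
  have 1: "(?e \<longlongrightarrow> ?E) ?F"
    by (intro tendsto_intros tendsto_central tendsto_viscosity I0_lim flux_lim k_lim)
  have "\<forall>\<^sub>F \<epsilon> in ?F. ?e \<epsilon> = 0"
    using sol unfolding divide_inverse[symmetric] by eventually_elim (rule D(3))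
  \<comment> \<open>The constant 0 converges to \<open>?E\<close> along a nontrivial filter, so
    \<open>?E\<close> is 0.\<close>
  from Lim_transform_eventually[OF 1 this] have "?E = 0"
    by (simp add: tendsto_const_iff)
  moreover have "(?u (n + 1) i - ?u n i) * inverse (c * dt) = a * ((T0 (n + 1) i ^ 4 - T0 n i ^ 4) / dt)"
    using pos by (simp add: field_simps)
  \<comment> \<open>Here \<open>leg_a 0 = 1/3\<close> produces the diffusion coefficient, and two
    central differences with denominators \<open>2 * dx\<close> compose to the second difference of
    step \<open>2 * dx\<close>.\<close>
  moreover have "central dx (\<lambda>j. - (leg_a 0 * central dx (?u (n + 1)) j) / \<sigma>) i
      = - (a * c / (3 * \<sigma>) * ((T0 (n + 1) (i + 2) ^ 4 - 2 * T0 (n + 1) i ^ 4 + T0 (n + 1) (i - 2) ^ 4) / (4 * dx\<^sup>2)))"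
    using pos by (simp add: central_def leg_a_def power2_eq_square field_simps)
  moreover have "viscosity dx (?u (n + 1)) i
      = a * c * v_max / (2 * dx) * (T0 (n + 1) (i + 1) ^ 4 - 2 * T0 (n + 1) i ^ 4 + T0 (n + 1) (i - 1) ^ 4)"
    using pos by (simp add: viscosity_def field_simps)
  ultimately show ?thesis
    unfolding five_point_residual_def by linarith
qed

section \<open>Joint continuity and second differences\<close>

text \<open>A square neighbourhood contains the segments of constant time along which the mean value
  and Maclaurin arguments run.\<close>

lemma eventually_nhds_PairD:
  fixes t x :: real
  assumes "eventually P (nhds (t, x))"
  obtains d where "d > 0" "\<And>s y. \<bar>s - t\<bar> < d \<Longrightarrow> \<bar>y - x\<bar> < d \<Longrightarrow> P (s, y)"
proof -
  from assms obtain Q R where "eventually Q (nhds t)" "eventually R (nhds x)"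
    and P: "\<And>s y. Q s \<Longrightarrow> R y \<Longrightarrow> P (s, y)"
    unfolding nhds_prod eventually_prod_filter by blast
  then obtain d1 d2 where "d1 > 0" "d2 > 0"
    "\<And>s. dist s t < d1 \<Longrightarrow> Q s" "\<And>y. dist y x < d2 \<Longrightarrow> R y"
    by (auto simp: eventually_nhds_metric)
  then show ?thesis
    by (intro that[of "min d1 d2"]) (auto simp: dist_real_def intro!: P)
qed

text \<open>Unlike punctured neighbourhoods, full ones factor as a product filter via
  \<open>nhds_prod\<close>.\<close>

lemma isCont_iff_nhds: "isCont f a \<longleftrightarrow> (f \<longlongrightarrow> f a) (nhds a)"
  unfolding isCont_def by (rule tendsto_at_iff_tendsto_nhds)

text \<open>Near the point \<open>f'\<close> is bounded, so \<open>f s\<close> is Lipschitz in space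
  uniformly in \<open>s\<close>; this reduces the claim to continuity in time along the line
  \<open>y = x\<close>. It supplies joint continuity of the temperature, which \<open>C12_on\<close>
  states only for the derivatives.\<close>

lemma isCont_Pair_of_partial:
  fixes f f' :: "real \<Rightarrow> real \<Rightarrow> real"
  assumes f: "isCont (\<lambda>s. f s x) t"
    and deriv: "\<forall>\<^sub>F (s, y) in nhds (t, x). (f s has_real_derivative f' s y) (at y)"
    and f': "isCont (\<lambda>(s, y). f' s y) (t, x)"
  shows "isCont (\<lambda>(s, y). f s y) (t, x)"
proof -
  let ?N = "nhds t \<times>\<^sub>F nhds x"
  \<comment> \<open>Close to the point \<open>f'\<close> differs from \<open>f' t x\<close> by less
    than 1.\<close>
  define B where "B = \<bar>f' t x\<bar> + 1"
  have "\<forall>\<^sub>F p in nhds (t, x). dist ((\<lambda>(s, y). f' s y) p) (f' t x) < 1"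
    using f'[unfolded isCont_iff_nhds] by (intro tendstoD) auto
  with deriv have "\<forall>\<^sub>F p in nhds (t, x). case p of (s, y) \<Rightarrow>
      (f s has_real_derivative f' s y) (at y) \<and> \<bar>f' s y\<bar> \<le> B"
    by eventually_elim (auto simp: B_def dist_real_def)
  then obtain d where d: "d > 0" "\<And>s y. \<bar>s - t\<bar> < d \<Longrightarrow> \<bar>y - x\<bar> < d \<Longrightarrow>
      (f s has_real_derivative f' s y) (at y) \<and> \<bar>f' s y\<bar> \<le> B"
    by (rule eventually_nhds_PairD) auto
  have "\<forall>\<^sub>F s in nhds t. \<bar>s - t\<bar> < d" "\<forall>\<^sub>F y in nhds x. \<bar>y - x\<bar> < d"
    using d(1) by (auto simp: eventually_nhds_metric dist_real_def)
  then have "\<forall>\<^sub>F p in ?N. \<bar>fst p - t\<bar> < d \<and> \<bar>snd p - x\<bar> < d"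
    unfolding eventually_prod_filter by auto
  then have "\<forall>\<^sub>F p in ?N. norm (f (fst p) (snd p) - f (fst p) x) \<le> B * \<bar>snd p - x\<bar>"
  proof eventually_elim
    case (elim p)
    have "norm (f (fst p) (snd p) - f (fst p) x) \<le> B * norm (snd p - x)"
      by (rule field_differentiable_bound[of "ball x d" _ "f' (fst p)"])
        (use elim d in \<open>auto simp: dist_real_def abs_minus_commute intro: has_field_derivative_at_within\<close>)
    then show ?case by simp
  qed
  moreover have "((\<lambda>p. B * \<bar>snd p - x\<bar>) \<longlongrightarrow> B * \<bar>x - x\<bar>) ?N"
    by (intro tendsto_mult tendsto_const tendsto_rabs tendsto_diff filterlim_snd)
  ultimately have "((\<lambda>p. f (fst p) (snd p) - f (fst p) x) \<longlongrightarrow> 0) ?N"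
    by (simp add: Lim_null_comparison)
  moreover have "((\<lambda>p. f (fst p) x) \<longlongrightarrow> f t x) ?N"
    using f[unfolded isCont_iff_nhds]
    by (rule filterlim_compose[OF _ filterlim_fst])
  ultimately have "((\<lambda>p. f (fst p) (snd p) - f (fst p) x + f (fst p) x) \<longlongrightarrow> 0 + f t x) ?N"
    by (rule tendsto_add)
  then show ?thesis
    by (simp add: isCont_iff_nhds nhds_prod case_prod_unfold)
qed

text \<open>The sum of \<open>f (x + s)\<close> and \<open>f (x - s)\<close> is even in
  \<open>s\<close>, so its Maclaurin expansion has no linear term, and the Lagrange remainder gives
  one \<open>s\<close> serving both sides. Existence of \<open>f''\<close> is enough for this; its
  continuity enters only in the limit.\<close>

lemma second_difference_eq:
  fixes f f' f'' :: "real \<Rightarrow> real"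
  assumes "h > 0"
    and f: "\<And>y. \<bar>y - x\<bar> \<le> h \<Longrightarrow> (f has_real_derivative f' y) (at y)"
    and f': "\<And>y. \<bar>y - x\<bar> \<le> h \<Longrightarrow> (f' has_real_derivative f'' y) (at y)"
  shows "\<exists>s. 0 < s \<and> s < h \<and>
    (f (x + h) - 2 * f x + f (x - h)) / h\<^sup>2 = (f'' (x + s) + f'' (x - s)) / 2"
proof -
  define D where "D m = (\<lambda>s. if m = 0 then f (x + s) + f (x - s)
    else if m = 1 then f' (x + s) - f' (x - s) else f'' (x + s) + f'' (x - s))" for m :: nat
  have "\<exists>s. 0 < s \<and> s < h \<and> D 0 h = (\<Sum>m<2. D m 0 / fact m * h ^ m) + D 2 s / fact 2 * h ^ 2"
  proof (intro Maclaurin assms allI impI)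
    fix m :: nat and s :: real
    assume "m < 2 \<and> 0 \<le> s \<and> s \<le> h"
    then have m: "m = 0 \<or> m = 1" and s: "\<bar>(x + s) - x\<bar> \<le> h" "\<bar>(x - s) - x\<bar> \<le> h" by auto
    have plus: "((\<lambda>z. g (x + z)) has_real_derivative e) (at s)"
      if "(g has_real_derivative e) (at (x + s))" for g e
      using that by (simp add: DERIV_shift add.commute)
    have minus: "((\<lambda>z. g (x - z)) has_real_derivative - e) (at s)"
      if "(g has_real_derivative e) (at (x - s))" for g e
    proof -
      have "((\<lambda>z. x - z) has_real_derivative - 1) (at s)"
        by (auto intro!: derivative_eq_intros)
      from DERIV_chain2[OF that this] show ?thesis by simp
    qed
    from m show "(D m has_real_derivative D (Suc m) s) (at s)"
    proof
      assume "m = 0"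
      with DERIV_add[OF plus[OF f[OF s(1)]] minus[OF f[OF s(2)]]] show ?thesis
        by (simp add: D_def)
    next
      assume "m = 1"
      with DERIV_diff[OF plus[OF f'[OF s(1)]] minus[OF f'[OF s(2)]]] show ?thesis
        by (simp add: D_def)
    qed
  qed auto
  then show ?thesis
    using assms(1) by (auto simp: D_def numeral_2_eq_2 field_simps)
qed

text \<open>The difference is taken at time \<open>t + k\<close>, and the intermediate point depends
  on both \<open>k\<close> and \<open>h\<close>. Joint continuity of \<open>f''\<close> keeps both
  remainder values within \<open>e\<close> of \<open>f'' t x\<close>, and hence their mean, with no
  relation between \<open>k\<close> and \<open>h\<close>.\<close>

lemma second_difference_tendsto:
  fixes f f' f'' :: "real \<Rightarrow> real \<Rightarrow> real"
  assumes f: "\<forall>\<^sub>F (s, y) in nhds (t, x). (f s has_real_derivative f' s y) (at y)"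
    and f': "\<forall>\<^sub>F (s, y) in nhds (t, x). (f' s has_real_derivative f'' s y) (at y)"
    and cont: "isCont (\<lambda>(s, y). f'' s y) (t, x)"
  shows "((\<lambda>(k, h). (f (t + k) (x + h) - 2 * f (t + k) x + f (t + k) (x - h)) / h\<^sup>2)
    \<longlongrightarrow> f'' t x) (at_right 0 \<times>\<^sub>F at_right 0)"
proof (rule tendstoI)
  fix e :: real assume "e > 0"
  then have "\<forall>\<^sub>F p in nhds (t, x). dist ((\<lambda>(s, y). f'' s y) p) (f'' t x) < e"
    using cont[unfolded isCont_iff_nhds] by (intro tendstoD) auto
  with f f' have "\<forall>\<^sub>F p in nhds (t, x). case p of (s, y) \<Rightarrow> (f s has_real_derivative f' s y) (at y) \<and>
      (f' s has_real_derivative f'' s y) (at y) \<and> \<bar>f'' s y - f'' t x\<bar> < e"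
    by eventually_elim (auto simp: dist_real_def)
  then obtain d where d: "d > 0" "\<And>s y. \<bar>s - t\<bar> < d \<Longrightarrow> \<bar>y - x\<bar> < d \<Longrightarrow>
      (f s has_real_derivative f' s y) (at y) \<and>
      (f' s has_real_derivative f'' s y) (at y) \<and> \<bar>f'' s y - f'' t x\<bar> < e"
    by (rule eventually_nhds_PairD) auto
  have "\<forall>\<^sub>F k in at_right 0. 0 < k \<and> k < d"
    using d(1) by (auto simp: eventually_at_right)
  then have "\<forall>\<^sub>F p in at_right 0 \<times>\<^sub>F at_right 0. (0 < fst p \<and> fst p < d) \<and> (0 < snd p \<and> snd p < d)"
    unfolding eventually_prod_filter by auto
  then show "\<forall>\<^sub>F p in at_right 0 \<times>\<^sub>F at_right 0.
    dist (case p of (k, h) \<Rightarrow> (f (t + k) (x + h) - 2 * f (t + k) x + f (t + k) (x - h)) / h\<^sup>2) (f'' t x) < e"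
  proof eventually_elim
    case (elim p)
    obtain k h where p: "p = (k, h)" by force
    obtain s where s: "0 < s" "s < h"
      "(f (t + k) (x + h) - 2 * f (t + k) x + f (t + k) (x - h)) / h\<^sup>2
        = (f'' (t + k) (x + s) + f'' (t + k) (x - s)) / 2"
      using second_difference_eq[of h x "f (t + k)" "f' (t + k)" "f'' (t + k)"] elim d(2) p
      by auto
    have "\<bar>f'' (t + k) (x + s) - f'' t x\<bar> < e" "\<bar>f'' (t + k) (x - s) - f'' t x\<bar> < e"
      using d(2)[of "t + k" "x + s"] d(2)[of "t + k" "x - s"] s elim p by auto
    then show ?case
      unfolding p case_prod_conv s(3) dist_real_def abs_less_iff by (auto simp: field_simps)
  qed
qed

section \<open>Consistency with the diffusion equation\<close>

text \<open>Both spatial differences are second differences of the fourth power of \<open>T\<close>,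
  with steps \<open>2 * dx\<close> and \<open>dx\<close>. The first gives the diffusion term; the
  second carries a spare factor \<open>dx\<close> and vanishes.\<close>

lemma five_point_consistentI:
  assumes Cv_cont: "\<And>x. continuous_on UNIV (Cv x)"
    and theta_cont: "continuous_on UNIV (\<lambda>(S, S'). \<theta> S S')"
    and theta_diag: "\<And>S. \<theta> S S = S"
  shows "five_point_consistent c a \<sigma> Cv \<theta>"
  unfolding five_point_consistent_def
proof (intro allI impI)
  fix \<Omega> T t x
  assume \<Omega>: "open \<Omega>" and "C12_on \<Omega> T" and tx: "(t, x) \<in> \<Omega>"
  then obtain Tt Tx Txx where
    Tt: "\<And>t x. (t, x) \<in> \<Omega> \<Longrightarrow> ((\<lambda>s. T s x) has_real_derivative Tt t x) (at t)" and
    Tx: "\<And>t x. (t, x) \<in> \<Omega> \<Longrightarrow> (T t has_real_derivative Tx t x) (at x)" and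
    Txx: "\<And>t x. (t, x) \<in> \<Omega> \<Longrightarrow> (Tx t has_real_derivative Txx t x) (at x)" and
    cont: "continuous_on \<Omega> (\<lambda>(t, x). Tx t x)" "continuous_on \<Omega> (\<lambda>(t, x). Txx t x)"
    unfolding C12_on_def by blast
  let ?F = "at_right (0::real) \<times>\<^sub>F at_right (0::real)"
  define U where "U = (\<lambda>s y. T s y ^ 4)"
  define Ux where "Ux s y = 4 * T s y ^ 3 * Tx s y" for s y
  define Uxx where "Uxx s y = 12 * T s y ^ 2 * Tx s y ^ 2 + 4 * T s y ^ 3 * Txx s y" for s y
  define Ut where "Ut = 4 * T t x ^ 3 * Tt t x"
  have U: "(U s has_real_derivative Ux s y) (at y)" if "(s, y) \<in> \<Omega>" for s y
    unfolding U_def Ux_def by (auto intro!: derivative_eq_intros Tx[OF that])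
  have Ux: "(Ux s has_real_derivative Uxx s y) (at y)" if "(s, y) \<in> \<Omega>" for s y
    unfolding Uxx_def Ux_def
    by (auto intro!: derivative_eq_intros Tx[OF that] Txx[OF that] simp: power2_eq_square)
  have Ut: "((\<lambda>s. U s x) has_real_derivative Ut) (at t)"
    unfolding U_def Ut_def by (auto intro!: derivative_eq_intros Tt[OF tx])
  have ev: "\<forall>\<^sub>F p in nhds (t, x). p \<in> \<Omega>"
    using \<Omega> tx by (rule eventually_nhds_in_open)
  have contx: "isCont (\<lambda>(s, y). Tx s y) (t, x)" "isCont (\<lambda>(s, y). Txx s y) (t, x)"
    using cont \<Omega> tx by (auto simp: continuous_on_eq_continuous_at)
  have "isCont (\<lambda>(s, y). T s y) (t, x)"
  proof (rule isCont_Pair_of_partial)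
    show "isCont (\<lambda>s. T s x) t" using Tt[OF tx] by (rule DERIV_isCont)
    show "\<forall>\<^sub>F (s, y) in nhds (t, x). (T s has_real_derivative Tx s y) (at y)"
      using ev by eventually_elim (auto intro: Tx)
  qed (rule contx)
  with contx have "isCont (\<lambda>(s, y). Uxx s y) (t, x)"
    unfolding Uxx_def case_prod_beta by (intro continuous_intros)
  then have sd: "((\<lambda>(k, h). (U (t + k) (x + h) - 2 * U (t + k) x + U (t + k) (x - h)) / h\<^sup>2)
      \<longlongrightarrow> Uxx t x) ?F" (is "(?D \<longlongrightarrow> _) _")
    using ev by (intro second_difference_tendsto[where f' = Ux]) (auto elim!: eventually_mono intro: U Ux)
  have snd0: "(snd \<longlongrightarrow> 0) ?F"
    by (rule filterlim_compose[OF tendsto_ident_at filterlim_snd])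
  \<comment> \<open>Doubling the step preserves the filter, so the wide difference is
    \<open>?D\<close> at step \<open>2 * dx\<close>, whose square is the denominator
    \<open>4 * dx\<^sup>2\<close>.\<close>
  have "filterlim (\<lambda>p. (fst p, 2 * snd p)) ?F ?F"
  proof (rule filterlim_Pair[OF filterlim_fst])
    have "filterlim (\<lambda>h::real. 2 * h) (at_right 0) (at_right 0)"
      by (rule filterlim_at_withinI) (auto intro!: tendsto_eq_intros simp: eventually_at_right_less)
    then show "filterlim (\<lambda>p. 2 * snd p) (at_right 0) ?F"
      by (rule filterlim_compose[OF _ filterlim_snd])
  qed
  from filterlim_compose[OF sd this]
  have wide: "((\<lambda>p. ?D (fst p, 2 * snd p)) \<longlongrightarrow> Uxx t x) ?F" .
  have quot: "((\<lambda>p. (f (t + fst p) - f t) / fst p) \<longlongrightarrow> D) ?F"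
    if "(f has_real_derivative D) (at t)" for f D
  proof (rule filterlim_compose[OF _ filterlim_fst])
    show "((\<lambda>k. (f (t + k) - f t) / k) \<longlongrightarrow> D) (at_right 0)"
      using that unfolding DERIV_def by (rule tendsto_mono[OF at_le, rotated]) auto
  qed
  have "((\<lambda>p. T (t + fst p) x) \<longlongrightarrow> T t x) ?F"
  proof (rule filterlim_compose[OF _ filterlim_fst])
    have "((\<lambda>k. T (t + k) x) \<longlongrightarrow> T t x) (at 0)"
      using DERIV_isCont[OF Tt[OF tx]] by (simp add: isCont_iff)
    then show "((\<lambda>k. T (t + k) x) \<longlongrightarrow> T t x) (at_right 0)"
      by (rule tendsto_mono[OF at_le, rotated]) auto
  qed
  then have "((\<lambda>p. (\<lambda>(S, S'). \<theta> S S') (T t x, T (t + fst p) x)) \<longlongrightarrow> (\<lambda>(S, S'). \<theta> S S') (T t x, T t x)) ?F"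
    by (intro continuous_on_tendsto_compose[OF theta_cont] tendsto_intros) auto
  \<comment> \<open>Old and new temperature have the same limit, and \<open>theta_diag\<close> fixes
    the value of \<open>\<theta>\<close> there.\<close>
  then have "((\<lambda>p. \<theta> (T t x) (T (t + fst p) x)) \<longlongrightarrow> T t x) ?F"
    by (simp add: theta_diag)
  then have Cv: "((\<lambda>p. Cv x (\<theta> (T t x) (T (t + fst p) x))) \<longlongrightarrow> Cv x (T t x)) ?F"
    by (intro continuous_on_tendsto_compose[OF Cv_cont]) auto
  \<comment> \<open>The numerical viscosity is written as \<open>snd p * ?D p\<close>: it divides by
    \<open>dx\<close> once, not twice, and so tends to 0 times \<open>Uxx t x\<close>.\<close>
  have lim: "((\<lambda>p. Cv x (\<theta> (T t x) (T (t + fst p) x)) * ((T (t + fst p) x - T t x) / fst p)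
        + a * ((U (t + fst p) x - U t x) / fst p)
        - a * c / (3 * \<sigma>) * ?D (fst p, 2 * snd p) - a * c * v_max / 2 * (snd p * ?D p))
      \<longlongrightarrow> Cv x (T t x) * Tt t x + a * Ut - a * c / (3 * \<sigma>) * Uxx t x - a * c * v_max / 2 * (0 * Uxx t x)) ?F"
    by (intro tendsto_diff tendsto_add tendsto_mult tendsto_const Cv snd0 sd wide quot Ut Tt[OF tx])
  have "((\<lambda>y. a * c / (3 * \<sigma>) * deriv (\<lambda>z. T t z ^ 4) y) has_real_derivative a * c / (3 * \<sigma>) * Uxx t x) (at x)"
  proof -
    \<comment> \<open>The outer \<open>deriv\<close> sees the inner one as a function, which
      therefore has to be identified on a whole neighbourhood of \<open>x\<close>; openness of
      \<open>\<Omega>\<close> provides it.\<close>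
    have "\<forall>\<^sub>F y in nhds x. (t, y) \<in> \<Omega>"
    proof -
      have "filterlim (\<lambda>y. (t, y)) (nhds (t, x)) (nhds x)"
        by (intro tendsto_intros filterlim_ident)
      then show ?thesis using ev by (rule eventually_compose_filterlim[rotated])
    qed
    then have "\<forall>\<^sub>F y in nhds x. a * c / (3 * \<sigma>) * deriv (\<lambda>z. T t z ^ 4) y = a * c / (3 * \<sigma>) * Ux t y"
      by eventually_elim (use U in \<open>auto simp: U_def dest!: DERIV_imp_deriv\<close>)
    moreover have "((\<lambda>y. a * c / (3 * \<sigma>) * Ux t y) has_real_derivative a * c / (3 * \<sigma>) * Uxx t x) (at x)"
      by (intro DERIV_cmult Ux tx)
    ultimately show ?thesis
      by (subst DERIV_cong_ev[OF refl _ refl])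
  qed
  then have "Cv x (T t x) * Tt t x + a * Ut - a * c / (3 * \<sigma>) * Uxx t x - a * c * v_max / 2 * (0 * Uxx t x)
      = diffusion_residual c a \<sigma> Cv T t x"
    using DERIV_imp_deriv[OF Tt[OF tx]] DERIV_imp_deriv[OF Ut]
    by (simp add: diffusion_residual_def DERIV_imp_deriv U_def)
  note lim = lim[unfolded this]
  have "\<forall>\<^sub>F p in ?F. snd p > 0"
    using eventually_at_right_less[of "0::real"] unfolding eventually_prod_filter by auto
  then have "\<forall>\<^sub>F p in ?F. Cv x (\<theta> (T t x) (T (t + fst p) x)) * ((T (t + fst p) x - T t x) / fst p)
        + a * ((U (t + fst p) x - U t x) / fst p)
        - a * c / (3 * \<sigma>) * ?D (fst p, 2 * snd p) - a * c * v_max / 2 * (snd p * ?D p)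
      = (\<lambda>(dt, dx). five_point_residual c a \<sigma> Cv \<theta> dx dt x (T t x)
            (T (t + dt) (x - 2 * dx)) (T (t + dt) (x - dx)) (T (t + dt) x)
            (T (t + dt) (x + dx)) (T (t + dt) (x + 2 * dx))) p"
    by eventually_elim (simp add: five_point_residual_def U_def case_prod_beta power2_eq_square)
  from Lim_transform_eventually[OF lim this]
  show "((\<lambda>(dt, dx). five_point_residual c a \<sigma> Cv \<theta> dx dt x (T t x)
            (T (t + dt) (x - 2 * dx)) (T (t + dt) (x - dx)) (T (t + dt) x)
            (T (t + dt) (x + dx)) (T (t + dt) (x + 2 * dx)))
          \<longlongrightarrow> diffusion_residual c a \<sigma> Cv T t x) ?F" .
qed

text \<open>The two conjuncts concern different limits: \<open>\<epsilon>\<close> to 0 with the mesh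
  fixed, and then the mesh parameters to 0. The second says in which sense the limiting scheme
  discretizes the diffusion equation.\<close>

theorem theorem3:
  fixes c a \<sigma> x0 dx dt :: real
    and Cv \<theta> :: "real \<Rightarrow> real \<Rightarrow> real"
    and M :: nat
    and I :: "real \<Rightarrow> nat \<Rightarrow> nat \<Rightarrow> int \<Rightarrow> real"
    and T :: "real \<Rightarrow> nat \<Rightarrow> int \<Rightarrow> real"
    and T0 :: "nat \<Rightarrow> int \<Rightarrow> real"
  assumes pos: "c > 0" "a > 0" "\<sigma> > 0" "dx > 0" "dt > 0"
    and order: "M \<ge> 1"
    and Cv_cont: "\<And>x. continuous_on UNIV (Cv x)"
    and theta_cont: "continuous_on UNIV (\<lambda>(S, S'). \<theta> S S')"
    and theta_diag: "\<And>S. \<theta> S S = S"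
    and scheme: "\<forall>\<^sub>F \<epsilon> in at_right 0. imex_PN_solution c a \<sigma> Cv \<theta> x0 dx dt M \<epsilon> (I \<epsilon>) (T \<epsilon>)"
    and T_lim: "\<And>n i. ((\<lambda>\<epsilon>. T \<epsilon> n i) \<longlongrightarrow> T0 n i) (at_right 0)"
    and I_bounded: "\<And>l n i. l \<le> M \<Longrightarrow> (\<lambda>\<epsilon>. I \<epsilon> l n i) \<in> O[at_right 0](\<lambda>_. 1)"
    and I_init: "\<And>l i. l \<le> M \<Longrightarrow>
      ((\<lambda>\<epsilon>. I \<epsilon> l 0 i) \<longlongrightarrow> planck_moment a c (T0 0 i) l) (at_right 0)"
  shows "(\<forall>n i. five_point_residual c a \<sigma> Cv \<theta> dx dt (cell x0 dx i) (T0 n i)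
            (T0 (n + 1) (i - 2)) (T0 (n + 1) (i - 1)) (T0 (n + 1) i)
            (T0 (n + 1) (i + 1)) (T0 (n + 1) (i + 2)) = 0) \<and>
         five_point_consistent c a \<sigma> Cv \<theta>"
proof (intro conjI allI)
  show "five_point_residual c a \<sigma> Cv \<theta> dx dt (cell x0 dx i) (T0 n i)
            (T0 (n + 1) (i - 2)) (T0 (n + 1) (i - 1)) (T0 (n + 1) i)
            (T0 (n + 1) (i + 1)) (T0 (n + 1) (i + 2)) = 0" for n i
    by (rule imex_PN_limit[where I = I and T = T and M = M]) (fact assms)+
  show "five_point_consistent c a \<sigma> Cv \<theta>"
    by (rule five_point_consistentI) (fact assms)+
qed

end
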